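(* Let $a<b$, let $n\ge1$ be an integer, suppose $a=c_0<c_1<\dots<c_r=b$, and suppose $f$ is a real-valued function on $[a,b]$ that has Lipschitz constant bounded by $L>0$ on each interval $(c_j,c_{j+1})$, $0\le j\le r-1$. Let $\mathbf{f}\in\mathbb{R}^{n+1}$ have entries $\mathbf{f}[k]=f(a_k)$, where $a_k=a+\frac{k}{n}(b-a)$, $0\le k\le n$. Then for all $1\le p\le\infty$, $$\Big|\|\mathbf{f}\|_{\nu_p}-\|f\|_{V^p}\Big|\le C\,\frac{(b-a)^{1+1/p}}{n}\left(L(b-a)+r\|f\|_{L^\infty}\right),$$ where $C>0$ is a universal constant. The same bound holds by replacing $f$ with $f_{\mathrm{cen}}$ and $\mathbf{f}$ with $\mathbf{f}_{\mathrm{cen}}$.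
   Context: For $p=\infty$, $1/p=0$. Here $\|f\|_{L^\infty}=\operatorname{ess\,sup}_{x\in[a,b]}|f(x)|$ is the essential supremum norm. Volterra $p$-norm: $(\mathcal{V}f)(x)=\int_a^xf(t)\,dt$ and $\|f\|_{V^p}=\|\mathcal{V}f\|_{L^p([a,b])}$. Discrete norms: for $\mathbf{v}\in\mathbb{R}^{n+1}$ (entries indexed $0,\dots,n$), $$\|\mathbf{v}\|_{\tau_p}=\left(\frac{b-a}{2n}\sum_{k=0}^{n-1}\left(|\mathbf{v}[k]|^p+|\mathbf{v}[k+1]|^p\right)\right)^{1/p}\ (1\le p<\infty),\qquad \|\mathbf{v}\|_{\tau_\infty}=\max_{0\le k\le n}|\mathbf{v}[k]|.$$ The discrete Volterra operator $\mathbf{V}:\mathbb{R}^{n+1}\to\mathbb{R}^{n+1}$ is $(\mathbf{V}\mathbf{x})[0]=0$ and $(\mathbf{V}\mathbf{x})[k]=\frac{b-a}{2n}\sum_{j=0}^{k-1}(\mathbf{x}[j]+\mathbf{x}[j+1])$ for $1\le k\le n$; and $\|\mathbf{x}\|_{\nu_p}=\|\mathbf{V}\mathbf{x}\|_{\tau_p}$. Centering: $\mu(f)=\frac1{b-a}\int_a^bf(t)\,dt$ and $f_{\mathrm{cen}}(x)=f(x)-\mu(f)$. For $\mathbf{w}\in\mathbb{R}^{n+1}$, $\mathrm{m}(\mathbf{w})=\frac1{2n}\sum_{k=0}^{n-1}(\mathbf{w}[k]+\mathbf{w}[k+1])$ and $\mathbf{w}_{\mathrm{cen}}[k]=\mathbf{w}[k]-\mathrm{m}(\mathbf{w})$,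 $0\le k\le n$; thus $\mathbf{f}_{\mathrm{cen}}$ is obtained from $\mathbf{f}$ in this way.
   Formalization: Added hypothesis: at each sample point a_k that is a breakpoint c_j, |f(a_k)| ≤ ‖f‖_{L^∞} (for the centred bound with ‖f_cen‖ on the right, the same for f_cen); without it the claim fails, since the essential supremum ignores f(c_j). *)

theory Defs
  imports "HOL-Analysis.Analysis" "HOL-Probability.Essential_Supremum"
begin

(* The exponent p ranges over the extended reals with 1 <= p; in ereal, 1 / \<infinity> = 0, so
   real_of_ereal (1 / p) is 1/p with the convention 1/\<infinity> = 0. *)

definition Lp_norm :: "real \<Rightarrow> real \<Rightarrow> ereal \<Rightarrow> (real \<Rightarrow> real) \<Rightarrow> real" where
  "Lp_norm a b p f =
    (if p = \<infinity> then real_of_ereal (esssup (lebesgue_on {a..b}) (\<lambda>x. ereal \<bar>f x\<bar>))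
     else (LINT x|lebesgue_on {a..b}. \<bar>f x\<bar> powr real_of_ereal p) powr real_of_ereal (1 / p))"

definition volterra :: "real \<Rightarrow> (real \<Rightarrow> real) \<Rightarrow> real \<Rightarrow> real" where
  "volterra a f x = (LINT t|lebesgue_on {a..x}. f t)"

definition Vp_norm :: "real \<Rightarrow> real \<Rightarrow> ereal \<Rightarrow> (real \<Rightarrow> real) \<Rightarrow> real" where
  "Vp_norm a b p f = Lp_norm a b p (volterra a f)"

(* A vector in R^(n+1) is a function on nat of which only the entries 0, ..., n are used. *)

definition tau_norm :: "real \<Rightarrow> real \<Rightarrow> nat \<Rightarrow> ereal \<Rightarrow> (nat \<Rightarrow> real) \<Rightarrow> real" where
  "tau_norm a b n p v =
    (if p = \<infinity> then Max ((\<lambda>k. \<bar>v k\<bar>) ` {0..n})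
     else ((b - a) / (2 * real n) *
            (\<Sum>k<n. \<bar>v k\<bar> powr real_of_ereal p + \<bar>v (Suc k)\<bar> powr real_of_ereal p))
          powr real_of_ereal (1 / p))"

(* For k = 0 the sum is empty, which gives the entry 0. *)
definition dvolterra :: "real \<Rightarrow> real \<Rightarrow> nat \<Rightarrow> (nat \<Rightarrow> real) \<Rightarrow> nat \<Rightarrow> real" where
  "dvolterra a b n x k = (b - a) / (2 * real n) * (\<Sum>j<k. x j + x (Suc j))"

definition nu_norm :: "real \<Rightarrow> real \<Rightarrow> nat \<Rightarrow> ereal \<Rightarrow> (nat \<Rightarrow> real) \<Rightarrow> real" where
  "nu_norm a b n p x = tau_norm a b n p (dvolterra a b n x)"

definition mean :: "real \<Rightarrow> real \<Rightarrow> (real \<Rightarrow> real) \<Rightarrow> real" where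
  "mean a b f = 1 / (b - a) * (LINT t|lebesgue_on {a..b}. f t)"

definition cen :: "real \<Rightarrow> real \<Rightarrow> (real \<Rightarrow> real) \<Rightarrow> real \<Rightarrow> real" where
  "cen a b f x = f x - mean a b f"

definition dmean :: "nat \<Rightarrow> (nat \<Rightarrow> real) \<Rightarrow> real" where
  "dmean n w = 1 / (2 * real n) * (\<Sum>k<n. w k + w (Suc k))"

definition dcen :: "nat \<Rightarrow> (nat \<Rightarrow> real) \<Rightarrow> nat \<Rightarrow> real" where
  "dcen n w k = w k - dmean n w"

definition grid :: "real \<Rightarrow> real \<Rightarrow> nat \<Rightarrow> nat \<Rightarrow> real" where
  "grid a b n k = a + real k / real n * (b - a)"

definition samples :: "real \<Rightarrow> real \<Rightarrow> nat \<Rightarrow> (real \<Rightarrow> real) \<Rightarrow> nat \<Rightarrow> real" where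
  "samples a b n f k = f (grid a b n k)"

definition is_partition :: "real \<Rightarrow> real \<Rightarrow> nat \<Rightarrow> (nat \<Rightarrow> real) \<Rightarrow> bool" where
  "is_partition a b r c \<longleftrightarrow> c 0 = a \<and> c r = b \<and> (\<forall>j<r. c j < c (Suc j))"

(* The Lipschitz condition on the open intervals says nothing about the values f (c j), and the
   essential supremum does not see them, while the samples do. Without control of the breakpoint
   values that are sampled, no bound by the essential supremum can hold: on [0,1] with n = r = 2
   and c 1 = 1/2, let f vanish except for f (1/2) = M; then nu_norm 0 1 2 \<infinity> (samples 0 1 2 f) = M / 2,
   whereas Vp_norm 0 1 \<infinity> f = 0 = Lp_norm 0 1 \<infinity> f. The condition below is automatic at sample
   points that are not breakpoints, and at breakpoints where f is continuous from one side
   (within [a,b]). *)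
definition breakpoint_samples_bounded ::
    "real \<Rightarrow> real \<Rightarrow> nat \<Rightarrow> nat \<Rightarrow> (nat \<Rightarrow> real) \<Rightarrow> (real \<Rightarrow> real) \<Rightarrow> bool" where
  "breakpoint_samples_bounded a b n r c f \<longleftrightarrow>
    (\<forall>k\<le>n. grid a b n k \<in> c ` {0..r} \<longrightarrow> \<bar>f (grid a b n k)\<bar> \<le> Lp_norm a b \<infinity> f)"

definition error_bound ::
    "real \<Rightarrow> real \<Rightarrow> nat \<Rightarrow> nat \<Rightarrow> real \<Rightarrow> ereal \<Rightarrow> (real \<Rightarrow> real) \<Rightarrow> real" where
  "error_bound a b n r L p f =
    (b - a) powr (1 + real_of_ereal (1 / p)) / real n * (L * (b - a) + real r * Lp_norm a b \<infinity> f)"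

end

theory Submission
  imports Defs
begin

text \<open>
  Write \<open>h = (b - a) / n\<close> and let \<open>M\<close> be the essential supremum of \<open>|f|\<close>. The proof separates the
  approximation of the primitive from the comparison of norms.

  The discrete Volterra operator is the composite trapezoidal rule, so \<^const>\<open>dvolterra\<close> of the
  samples approximates \<^const>\<open>volterra\<close> at the grid points. A cell that contains no breakpoint has
  error at most \<open>L h\<^sup>2\<close>, by the Lipschitz condition; any other cell has error at most \<open>2 M h\<close>, and
  there are at most \<open>4 r\<close> of those. Adding up gives an error of order \<open>h (L (b - a) + r M)\<close>
  (\<open>trapezoid_error\<close>). The primitive is \<open>M\<close>-Lipschitz (\<open>volterra_diff_le\<close>), so on each whole cell
  it stays close to both discrete endpoint values to the same order, because \<open>r \<ge> 1\<close>.

  The discrete norm is the \<open>L\<^sup>p\<close> norm of a step function that takes these endpoint values, and a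
  uniform distance \<open>D\<close> between two functions on an interval of length \<open>b - a\<close> changes the norm by at
  most \<open>D (b - a)\<^bsup>1/p\<^esup>\<close> (\<open>tau_norm_Lp_norm_close\<close>). This triangle inequality between a sum and an
  integral follows from a weighted form of convexity of the \<open>q\<close>-th power
  (\<open>powr_inverse_le_add\<close>).

  Centring subtracts linear functions from the two primitives, with slopes equal to the two means.
  Since a mean is the final value of the primitive divided by \<open>b - a\<close>, the same trapezoidal estimate
  controls their difference, and the error bound only doubles.
\<close>

section \<open>A triangle inequality from weighted convexity\<close>

text \<open>Jensen's inequality for \<^term>\<open>\<lambda>t::real. t powr q\<close> at the points \<^term>\<open>x / A\<close> and
  \<^term>\<open>y / B\<close> (times \<^term>\<open>A + B\<close>) with weights \<^term>\<open>A / (A + B)\<close> and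
  \<^term>\<open>B / (A + B)\<close>. It is linear in the two powers on the right, so it can be integrated and
  summed.\<close>

lemma powr_add_le_weighted:
  fixes q x y A B :: real
  assumes q: "1 \<le> q" and "0 \<le> x" "0 \<le> y" and A: "0 < A" and B: "0 < B"
  shows "(x + y) powr q \<le> ((A + B) / A) powr (q - 1) * x powr q + ((A + B) / B) powr (q - 1) * y powr q"
proof -
  have one: "1 \<le> ((A + B) / A) powr (q - 1)" "1 \<le> ((A + B) / B) powr (q - 1)"
    using q A B by (auto intro!: ge_one_powr_ge_zero simp: field_simps)
  consider "x = 0" | "y = 0" | "0 < x" "0 < y"
    using assms by linarith
  then show ?thesis
  proof cases
    case 1
    then show ?thesis
      using one(2) mult_right_mono[OF one(2), of "y powr q"] by simp
  next
    case 2
    then show ?thesis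
      using mult_right_mono[OF one(1), of "x powr q"] by simp
  next
    case 3
    \<comment> \<open>Jensen's inequality is applied to positive numbers; if a summand vanishes, it suffices that the
      coefficient of the other one is at least 1.\<close>
    define s where "s = A + B"
    have s: "0 < s" using A B by (simp add: s_def)
    have scale: "(C / s) * (u / (C / s)) powr q = (s / C) powr (q - 1) * u powr q" if "0 < u" "0 < C" for u C
    proof -
      have "(u / (C / s)) powr q = u powr q * ((s / C) powr (q - 1) * (s / C))"
        using that s by (simp add: powr_divide powr_mult powr_diff field_simps)
      then show ?thesis using that s by (simp add: field_simps)
    qed
    have conv: "((1 - t) * u + t * v) powr q \<le> (1 - t) * u powr q + t * v powr q"
      if "0 \<le> t" "t \<le> 1" "0 < u" "0 < v" for t u v
      using convex_onD[OF powr_convex[OF q], of t u v] that by simp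
    have t: "1 - B / s = A / s" "B / s \<le> 1" using A s by (simp_all add: s_def field_simps)
    have "((A / s) * (x / (A / s)) + (B / s) * (y / (B / s))) powr q
        \<le> (A / s) * (x / (A / s)) powr q + (B / s) * (y / (B / s)) powr q"
      unfolding t(1)[symmetric] using 3 A B s t by (intro conv) auto
    moreover have "(A / s) * (x / (A / s)) + (B / s) * (y / (B / s)) = x + y"
      using A B s by simp
    ultimately show ?thesis
      using scale[OF 3(1) A] scale[OF 3(2) B] by (simp add: s_def)
  qed
qed

text \<open>This is the final step in the proof of Minkowski's inequality, separated from the measure
  space. Think of \<^term>\<open>T\<close> and \<^term>\<open>I\<close> as the \<^term>\<open>q\<close>-th powers of two norms over a space
  of mass \<^term>\<open>w\<close>, the functions differing by at most \<^term>\<open>D\<close>. Whatever linear estimate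
  holds pointwise for \<^term>\<open>(x + D) powr q\<close> is assumed to hold after integration. Choosing the
  coefficients of the weighted convexity inequality with \<^term>\<open>A\<close> and \<^term>\<open>B\<close> equal (up to an
  arbitrarily small error) to the norms of the two summands collapses the right-hand side to
  \<^term>\<open>(A + B) powr q\<close>. Because the two norms enter symmetrically, one may be a
  finite sum and the other an integral, in either order.\<close>

lemma powr_inverse_le_add:
  fixes q D w T I :: real
  assumes q: "1 \<le> q" and D: "0 < D" and w: "0 < w" and T: "0 \<le> T" and I: "0 \<le> I"
    and le: "\<And>\<alpha> \<beta>. 0 \<le> \<alpha> \<Longrightarrow> 0 \<le> \<beta> \<Longrightarrow> (\<And>x. 0 \<le> x \<Longrightarrow> (x + D) powr q \<le> \<alpha> * x powr q + \<beta> * D powr q)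
      \<Longrightarrow> I \<le> \<alpha> * T + \<beta> * (w * D powr q)"
  shows "I powr (1 / q) \<le> T powr (1 / q) + D * w powr (1 / q)"
proof (rule field_le_epsilon)
  fix e :: real assume e: "0 < e"
  \<comment> \<open>The \<^term>\<open>e\<close> makes \<^term>\<open>A\<close> positive even if \<^term>\<open>T = 0\<close>.\<close>
  define A where "A = T powr (1 / q) + e"
  define B where "B = D * w powr (1 / q)"
  have A: "0 < A" using e by (simp add: A_def add_nonneg_pos)
  have B: "0 < B" using D w by (simp add: B_def)
  have TA: "T \<le> A powr q"
  proof -
    have "(T powr (1 / q)) powr q \<le> A powr q"
      using q e by (intro powr_mono2) (auto simp: A_def)
    then show ?thesis using q T by (simp add: powr_powr)
  qed
  have wB: "w * D powr q = B powr q"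
    using q D w by (simp add: B_def powr_mult powr_powr)
  have part: "((A + B) / C) powr (q - 1) * C powr q = (A + B) powr (q - 1) * C" if "0 < C" for C
    using that A B by (simp add: powr_divide powr_diff)
  have "I \<le> ((A + B) / A) powr (q - 1) * T + ((A + B) / B) powr (q - 1) * (w * D powr q)"
    using powr_add_le_weighted[OF q _ _ A B] D by (intro le) auto
  also have "\<dots> \<le> ((A + B) / A) powr (q - 1) * A powr q + ((A + B) / B) powr (q - 1) * B powr q"
    using TA unfolding wB by (intro add_right_mono mult_left_mono) auto
  also have "\<dots> = (A + B) powr (q - 1) * (A + B)"
    by (simp only: part[OF A] part[OF B] distrib_left)
  also have "\<dots> = (A + B) powr q"
    using A B by (simp add: powr_diff)
  finally have "I powr (1 / q) \<le> ((A + B) powr q) powr (1 / q)"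
    using q I by (intro powr_mono2) auto
  then show "I powr (1 / q) \<le> T powr (1 / q) + D * w powr (1 / q) + e"
    using q A B by (simp add: powr_powr A_def B_def algebra_simps)
qed

section \<open>The grid and the discrete operators\<close>

lemma grid_0 [simp]: "grid a b n 0 = a"
  by (simp add: grid_def)

lemma grid_end [simp]: "1 \<le> n \<Longrightarrow> grid a b n n = b"
  by (simp add: grid_def)

lemma grid_Suc: "grid a b n (Suc k) = grid a b n k + (b - a) / real n"
  by (simp add: grid_def add_divide_distrib algebra_simps)

lemma grid_mono: "a \<le> b \<Longrightarrow> j \<le> k \<Longrightarrow> grid a b n j \<le> grid a b n k"
  by (auto simp: grid_def intro!: mult_right_mono divide_right_mono)

lemma grid_in_Icc: "a \<le> b \<Longrightarrow> 1 \<le> n \<Longrightarrow> k \<le> n \<Longrightarrow> grid a b n k \<in> {a..b}"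
  using grid_mono[of a b 0 k n] grid_mono[of a b k n n] by auto

lemma integral_eq_sum_cells:
  fixes g :: "real \<Rightarrow> real"
  assumes "a \<le> b" "1 \<le> n" and g: "g integrable_on {a..b}" and "k \<le> n"
  shows "integral {a..grid a b n k} g = (\<Sum>j<k. integral {grid a b n j..grid a b n (Suc j)} g)"
  using \<open>k \<le> n\<close>
proof (induction k)
  case (Suc k)
  have "integral {a..grid a b n k} g + integral {grid a b n k..grid a b n (Suc k)} g
      = integral {a..grid a b n (Suc k)} g"
    using assms Suc.prems grid_in_Icc[of a b n k] grid_in_Icc[of a b n "Suc k"] grid_mono[of a b k "Suc k" n]
    by (intro Henstock_Kurzweil_Integration.integral_combine integrable_subinterval_real[OF g]) auto
  with Suc show ?case by simp
qed simp

text \<open>A point lies in at most one closed cell, or in two if it is a grid point. This limits how many cells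
  the discontinuities can spoil.\<close>

lemma card_cells_containing_le:
  assumes "a < b" "1 \<le> n"
  shows "card {j. j < n \<and> y \<in> {grid a b n j..grid a b n (Suc j)}} \<le> 2"
proof -
  \<comment> \<open>The index of \<^term>\<open>y\<close> on the grid, as a real number.\<close>
  define t where "t = (y - a) * real n / (b - a)"
  have "{j. j < n \<and> y \<in> {grid a b n j..grid a b n (Suc j)}} \<subseteq> {nat \<lfloor>t\<rfloor>, nat \<lfloor>t\<rfloor> - 1}"
  proof
    fix j assume "j \<in> {j. j < n \<and> y \<in> {grid a b n j..grid a b n (Suc j)}}"
    then have "real j \<le> t" "t \<le> real (Suc j)"
      using assms by (auto simp: grid_def t_def field_simps)
    then have "\<lfloor>t\<rfloor> = int j \<or> \<lfloor>t\<rfloor> = int j + 1"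
      by linarith
    then show "j \<in> {nat \<lfloor>t\<rfloor>, nat \<lfloor>t\<rfloor> - 1}" by auto
  qed
  then have "card {j. j < n \<and> y \<in> {grid a b n j..grid a b n (Suc j)}} \<le> card {nat \<lfloor>t\<rfloor>, nat \<lfloor>t\<rfloor> - 1}"
    by (intro card_mono) auto
  also have "\<dots> \<le> 2" by (simp add: card_insert_if)
  finally show ?thesis .
qed

lemma dvolterra_dcen:
  assumes "1 \<le> n"
  shows "dvolterra a b n (dcen n w) k = dvolterra a b n w k - dmean n w * (grid a b n k - a)"
  using assms by (simp add: dvolterra_def dcen_def grid_def sum.distrib sum_subtractf field_simps)

lemma dmean_mult: "a < b \<Longrightarrow> dmean n w * (b - a) = dvolterra a b n w n"
  by (simp add: dmean_def dvolterra_def)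

lemma dcen_samples_cen:
  assumes "1 \<le> n"
  shows "dcen n (samples a b n (cen a b f)) = dcen n (samples a b n f)"
  using assms by (auto simp: fun_eq_iff dcen_def dmean_def samples_def cen_def sum.distrib sum_subtractf field_simps)

section \<open>The essential supremum on an interval\<close>

text \<open>The value \<^term>\<open>Lp_norm a b \<infinity> f\<close> maps an extended real to a real, sending infinite
  values to 0. A nonempty interior and an almost everywhere bound keep the essential supremum finite,
  so that it is the least essential bound.\<close>

lemma Lp_norm_infinity_bounds:
  assumes "a < b" and meas: "f \<in> borel_measurable (lebesgue_on {a..b})"
    and bd: "AE x in lebesgue_on {a..b}. \<bar>f x\<bar> \<le> B"
  shows "AE x in lebesgue_on {a..b}. \<bar>f x\<bar> \<le> Lp_norm a b \<infinity> f" and "0 \<le> Lp_norm a b \<infinity> f"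
    and "Lp_norm a b \<infinity> f \<le> B"
proof -
  define M where "M = lebesgue_on {a..b}"
  define s where "s = esssup M (\<lambda>x. ereal \<bar>f x\<bar>)"
  have m: "(\<lambda>x. ereal \<bar>f x\<bar>) \<in> borel_measurable M"
    using meas unfolding M_def by measurable
  have "AE x in M. \<bar>f x\<bar> \<le> B"
    using bd unfolding M_def .
  then have sB: "s \<le> ereal B"
    unfolding s_def using m by (intro esssup_I) auto
  have pos: "emeasure M (space M) \<noteq> 0"
    using \<open>a < b\<close> by (simp add: M_def emeasure_restrict_space)
  have "esssup M (\<lambda>x. 0 :: ereal) \<le> s"
    unfolding s_def by (intro esssup_mono) auto
  then have s0: "0 \<le> s"
    using esssup_const[OF pos, of "0 :: ereal"] by simp
  have fin: "\<bar>s\<bar> \<noteq> \<infinity>"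
    using s0 sB by auto
  have L: "Lp_norm a b \<infinity> f = real_of_ereal s"
    by (simp add: Lp_norm_def s_def M_def)
  show "0 \<le> Lp_norm a b \<infinity> f"
    using s0 by (simp add: L real_of_ereal_pos)
  show "Lp_norm a b \<infinity> f \<le> B"
    using sB fin unfolding L by (metis ereal_less_eq(3) ereal_real')
  have "AE x in M. ereal \<bar>f x\<bar> \<le> s"
    unfolding s_def by (rule esssup_AE)
  then show "AE x in lebesgue_on {a..b}. \<bar>f x\<bar> \<le> Lp_norm a b \<infinity> f"
    unfolding L M_def[symmetric] using fin by (auto elim!: eventually_mono simp: ereal_le_real_iff)
qed

text \<open>An almost everywhere property holds at a point of every subinterval of positive length. This
  turns essential bounds into pointwise ones for functions with controlled oscillation.\<close>

lemma AE_Icc_ex: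
  assumes "AE x in lebesgue_on {a..b}. P x" and "c < d" and sub: "{c..d} \<subseteq> {a..b::real}"
  shows "\<exists>x. c < x \<and> x < d \<and> P x"
proof (rule ccontr)
  assume none: "\<not> (\<exists>x. c < x \<and> x < d \<and> P x)"
  then have no: "\<not> P x" if "c < x" "x < d" for x
    using that none by blast
  have "AE x in lebesgue. x \<in> {a..b} \<longrightarrow> P x"
    using assms(1) by (simp add: AE_restrict_space_iff)
  then have "AE x in lebesgue. x \<notin> {c<..<d}"
  proof (rule eventually_mono)
    fix x assume P: "x \<in> {a..b} \<longrightarrow> P x"
    show "x \<notin> {c<..<d}"
    proof
      assume x: "x \<in> {c<..<d}"
      then have "x \<in> {a..b}" using sub by auto
      with P no x show False by auto
    qed
  qed
  then have "emeasure lebesgue {c<..<d} = 0"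
    using AE_iff_null_sets[of "{c<..<d}" lebesgue] by auto
  then show False using \<open>c < d\<close> by simp
qed

section \<open>Comparing the discrete norm with the integral norm\<close>

text \<open>Each term of \<^const>\<open>tau_norm\<close> weights the two endpoint values of a cell by half the length of
  that cell, so it is the \<^term>\<open>p\<close>-norm of a step function uniformly \<^term>\<open>D\<close>-close to
  \<^term>\<open>F\<close>, and the statement is the triangle inequality. For finite \<^term>\<open>p\<close> the step function
  is never formed: the convexity estimate is applied to both endpoint values of a cell, the two
  results are averaged, integrated over the cell and summed. For \<^term>\<open>p = \<infinity>\<close> a maximal entry
  is compared with a point of an adjacent cell at which the essential supremum is a bound.\<close>

lemma tau_norm_Lp_norm_close:
  fixes F :: "real \<Rightarrow> real" and p :: ereal
  assumes ab: "a < b" and n: "1 \<le> n" and p: "1 \<le> p" and D: "0 < D"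
    and cont: "continuous_on {a..b} F"
    and close: "\<And>j x. j < n \<Longrightarrow> x \<in> {grid a b n j..grid a b n (Suc j)}
        \<Longrightarrow> \<bar>F x - v j\<bar> \<le> D \<and> \<bar>F x - v (Suc j)\<bar> \<le> D"
  shows "\<bar>tau_norm a b n p v - Lp_norm a b p F\<bar> \<le> D * (b - a) powr real_of_ereal (1 / p)"
proof (cases "p = \<infinity>")
  case True
  define m where "m = Max ((\<lambda>k. \<bar>v k\<bar>) ` {0..n})"
  have vm: "\<bar>v k\<bar> \<le> m" if "k \<le> n" for k
    using that by (auto simp: m_def intro!: Max_ge)
  obtain k where k: "k \<le> n" "\<bar>v k\<bar> = m"
  proof -
    have "m \<in> (\<lambda>k. \<bar>v k\<bar>) ` {0..n}"
      unfolding m_def by (intro Max_in) auto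
    then show ?thesis using that by auto
  qed
  have cell: "\<exists>j<n. x \<in> {grid a b n j..grid a b n (Suc j)}" if x: "x \<in> {a..b}" for x
  proof -
    have "\<exists>j<m. x \<le> grid a b n (Suc j) \<and> grid a b n j \<le> x" if "a \<le> x" "x \<le> grid a b n m" "0 < m" for m
      using that
    proof (induction m)
      case (Suc m)
      show ?case
      proof (cases "x \<le> grid a b n m \<and> 0 < m")
        case True
        with Suc show ?thesis by (metis less_Suc_eq)
      next
        case False
        with Suc.prems have "grid a b n m \<le> x" by (cases "m = 0") auto
        with Suc.prems show ?thesis by blast
      qed
    qed simp
    from this[of n] show ?thesis using x n by auto
  qed
  have meas: "F \<in> borel_measurable (lebesgue_on {a..b})"
    by (rule continuous_imp_measurable_on_sets_lebesgue[OF cont]) simp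
  have bd: "AE x in lebesgue_on {a..b}. \<bar>F x\<bar> \<le> m + D"
  proof (rule AE_I2)
    fix x assume "x \<in> space (lebesgue_on {a..b})"
    then obtain j where j: "j < n" "x \<in> {grid a b n j..grid a b n (Suc j)}"
      using cell by auto
    then show "\<bar>F x\<bar> \<le> m + D"
      using close[OF j] vm[of j] by auto
  qed
  note ess = Lp_norm_infinity_bounds[OF ab meas bd]
  have "m \<le> Lp_norm a b \<infinity> F + D"
  proof -
    \<comment> \<open>A cell that has the maximal entry at an endpoint: to its left only for the last entry.\<close>
    define j where "j = (if k = n then n - 1 else k)"
    have j: "j < n" "k = j \<or> k = Suc j"
      using n k by (auto simp: j_def)
    have lt: "grid a b n j < grid a b n (Suc j)"
      using ab n by (simp add: grid_Suc)
    have sub: "{grid a b n j..grid a b n (Suc j)} \<subseteq> {a..b}"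
      using grid_in_Icc[of a b n j] grid_in_Icc[of a b n "Suc j"] ab n j by auto
    obtain x where x: "grid a b n j < x" "x < grid a b n (Suc j)" "\<bar>F x\<bar> \<le> Lp_norm a b \<infinity> F"
      using AE_Icc_ex[OF ess(1) lt sub] by blast
    then show ?thesis
      using close[of j x] j k(2) by auto
  qed
  then show ?thesis
    using ess(3) True ab by (simp add: tau_norm_def m_def[symmetric])
next
  case False
  then obtain q where pq: "p = ereal q" and q: "1 \<le> q"
    using p by (cases p) auto
  define h where "h = (b - a) / real n"
  have h: "0 < h" using ab n by (simp add: h_def)
  have inv: "real_of_ereal (1 / p) = 1 / q"
    using q by (simp add: pq one_ereal_def)
  define G where "G = (\<lambda>x. \<bar>F x\<bar> powr q)"
  define s where "s = (\<lambda>j. (\<bar>v j\<bar> powr q + \<bar>v (Suc j)\<bar> powr q) / 2)"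
  define T where "T = h * (\<Sum>j<n. s j)"
  define I where "I = integral {a..b} G"
  have contG: "continuous_on {a..b} G"
    unfolding G_def using q by (intro continuous_on_powr' continuous_intros cont) auto
  then have intG: "G integrable_on {a..b}"
    by (rule integrable_continuous_real)
  have tau: "tau_norm a b n p v = T powr (1 / q)"
    using False inv by (simp add: tau_norm_def T_def s_def h_def pq sum_divide_distrib[symmetric] mult.commute)
  have Lp: "Lp_norm a b p F = I powr (1 / q)"
  proof -
    have "integrable (lebesgue_on {a..b}) G"
      using contG by (rule continuous_imp_integrable_real)
    then have "integral\<^sup>L (lebesgue_on {a..b}) G = I"
      unfolding I_def by (rule lebesgue_integral_eq_integral) simp
    then show ?thesis
      using False inv by (simp add: Lp_norm_def pq G_def)
  qed
  define J where "J = (\<lambda>j. integral {grid a b n j..grid a b n (Suc j)} G)"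
  have I_sum: "I = (\<Sum>j<n. J j)"
    using integral_eq_sum_cells[of a b n G n] ab n intG by (simp add: I_def J_def)
  have intJ: "G integrable_on {grid a b n j..grid a b n (Suc j)}" if "j < n" for j
    using that ab n grid_in_Icc[of a b n j] grid_in_Icc[of a b n "Suc j"]
    by (intro integrable_subinterval_real[OF intG]) auto
  have s0: "0 \<le> s j" for j by (simp add: s_def)
  have T0: "0 \<le> T" using h by (auto simp: T_def s_def intro!: mult_nonneg_nonneg sum_nonneg)
  have I0: "0 \<le> I" unfolding I_def by (intro integral_nonneg intG) (auto simp: G_def)
  have w: "b - a = real n * h" "0 < b - a" using ab n by (auto simp: h_def)
  have len: "grid a b n (Suc j) = grid a b n j + h" for j
    by (simp add: grid_Suc h_def)
  have I_le: "I \<le> \<alpha> * T + \<beta> * ((b - a) * D powr q)"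
    if \<alpha>: "0 \<le> \<alpha>" and \<beta>: "0 \<le> \<beta>"
      and conv: "\<And>x. 0 \<le> x \<Longrightarrow> (x + D) powr q \<le> \<alpha> * x powr q + \<beta> * D powr q" for \<alpha> \<beta>
  proof -
    have "J j \<le> h * (\<alpha> * s j + \<beta> * D powr q)" if j: "j < n" for j
    proof -
      have "G x \<le> \<alpha> * s j + \<beta> * D powr q" if x: "x \<in> {grid a b n j..grid a b n (Suc j)}" for x
      proof -
        have "G x \<le> \<alpha> * \<bar>v i\<bar> powr q + \<beta> * D powr q" if i: "i = j \<or> i = Suc j" for i
        proof -
          have "G x \<le> (\<bar>v i\<bar> + D) powr q"
            unfolding G_def using close[OF j x] i q by (intro powr_mono2) auto
          also have "\<dots> \<le> \<alpha> * \<bar>v i\<bar> powr q + \<beta> * D powr q"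
            by (rule conv) simp
          finally show ?thesis .
        qed
        from add_mono[OF this[of j] this[of "Suc j"]] show ?thesis
          by (simp add: s_def field_simps)
      qed
      then have "J j \<le> integral {grid a b n j..grid a b n (Suc j)} (\<lambda>x. \<alpha> * s j + \<beta> * D powr q)"
        unfolding J_def by (intro integral_le intJ j) auto
      then show ?thesis using h by (simp add: len)
    qed
    then have "I \<le> (\<Sum>j<n. h * (\<alpha> * s j + \<beta> * D powr q))"
      unfolding I_sum by (intro sum_mono) auto
    also have "\<dots> = \<alpha> * T + \<beta> * ((b - a) * D powr q)"
      by (simp add: T_def w sum.distrib sum_distrib_left algebra_simps)
    finally show ?thesis .
  qed
  have T_le: "T \<le> \<alpha> * I + \<beta> * ((b - a) * D powr q)"
    if \<alpha>: "0 \<le> \<alpha>" and \<beta>: "0 \<le> \<beta>"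
      and conv: "\<And>x. 0 \<le> x \<Longrightarrow> (x + D) powr q \<le> \<alpha> * x powr q + \<beta> * D powr q" for \<alpha> \<beta>
  proof -
    have "h * s j \<le> \<alpha> * J j + \<beta> * (h * D powr q)" if j: "j < n" for j
    proof -
      have "s j \<le> \<alpha> * G x + \<beta> * D powr q" if x: "x \<in> {grid a b n j..grid a b n (Suc j)}" for x
      proof -
        have "\<bar>v i\<bar> powr q \<le> (\<bar>F x\<bar> + D) powr q" if "i = j \<or> i = Suc j" for i
          using close[OF j x] that q by (intro powr_mono2) auto
        from this[of j] this[of "Suc j"] show ?thesis
          using conv[of "\<bar>F x\<bar>"] by (simp add: s_def G_def)
      qed
      then have "integral {grid a b n j..grid a b n (Suc j)} (\<lambda>x. s j)
          \<le> integral {grid a b n j..grid a b n (Suc j)} (\<lambda>x. \<alpha> * G x + \<beta> * D powr q)"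
        by (intro integral_le integrable_add integrable_on_mult_right intJ j) auto
      also have "\<dots> = \<alpha> * J j + \<beta> * (h * D powr q)"
        using h intJ[OF j] by (subst integral_add) (auto intro!: integrable_on_mult_right simp: J_def len)
      finally show ?thesis using h by (simp add: len)
    qed
    then have "T \<le> (\<Sum>j<n. \<alpha> * J j + \<beta> * (h * D powr q))"
      unfolding T_def sum_distrib_left by (intro sum_mono) auto
    also have "\<dots> = \<alpha> * I + \<beta> * ((b - a) * D powr q)"
      by (simp add: I_sum w sum.distrib sum_distrib_left algebra_simps)
    finally show ?thesis .
  qed
  have "I powr (1 / q) \<le> T powr (1 / q) + D * (b - a) powr (1 / q)"
    by (rule powr_inverse_le_add[OF q D w(2) T0 I0 I_le])
  moreover have "T powr (1 / q) \<le> I powr (1 / q) + D * (b - a) powr (1 / q)"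
    by (rule powr_inverse_le_add[OF q D w(2) I0 T0 T_le])
  ultimately show ?thesis
    unfolding tau Lp inv by linarith
qed

section \<open>Piecewise Lipschitz functions and their Volterra transforms\<close>

locale piecewise_lipschitz =
  fixes a b L :: real and r :: nat and c :: "nat \<Rightarrow> real" and f :: "real \<Rightarrow> real"
  assumes ab: "a < b" and part: "is_partition a b r c" and L: "0 < L"
    and lip: "\<And>j. j < r \<Longrightarrow> L-lipschitz_on {c j<..<c (Suc j)} f"
begin

abbreviation breaks :: "real set" where
  "breaks \<equiv> c ` {0..r}"

abbreviation M :: real where
  "M \<equiv> Lp_norm a b \<infinity> f"

lemma r_ge_1: "1 \<le> r"
  using part ab by (cases r) (auto simp: is_partition_def)

lemma between_breaks:
  assumes x: "x \<in> {a..b}" and nb: "x \<notin> breaks"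
  obtains i where "i < r" "c i < x" "x < c (Suc i)"
proof -
  have "\<exists>i<m. c i < x \<and> x < c (Suc i)" if "m \<le> r" "x \<le> c m" for m
    using that
  proof (induction m)
    case 0
    then have "x = c 0" using x part by (auto simp: is_partition_def)
    then show ?case using nb by auto
  next
    case (Suc m)
    have ne: "x \<noteq> c m" "x \<noteq> c (Suc m)"
      using nb Suc.prems by auto
    show ?case
    proof (cases "x < c m")
      case True
      with Suc show ?thesis by (metis less_Suc_eq less_imp_le Suc_leD)
    next
      case False
      with ne Suc.prems show ?thesis by auto
    qed
  qed
  from this[of r] show ?thesis
    using x part that by (auto simp: is_partition_def)
qed

lemma break_mono: "i \<le> j \<Longrightarrow> j \<le> r \<Longrightarrow> c i \<le> c j"
proof (induction j)
  case (Suc j)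
  have "c j < c (Suc j)"
    using part Suc.prems by (auto simp: is_partition_def)
  with Suc show ?case
    by (cases "i = Suc j") auto
qed simp

lemma piece_subset: "j < r \<Longrightarrow> {c j..c (Suc j)} \<subseteq> {a..b}"
  using break_mono[of 0 j] break_mono[of "Suc j" r] part by (auto simp: is_partition_def)

text \<open>Continuity on the open union of the pieces gives measurability there, and the remaining
  points of the interval are finitely many.\<close>

lemma measurable: "f \<in> borel_measurable (lebesgue_on {a..b})"
proof -
  define U where "U = (\<Union>j<r. {c j<..<c (Suc j)})"
  have U: "open U" by (auto simp: U_def)
  have contU: "continuous_on U f"
    unfolding U_def using lip by (intro continuous_on_open_UN) (auto intro: lipschitz_on_continuous_on)
  have leb: "U \<in> sets lebesgue" using U by (simp add: lborelD)
  have "f \<in> borel_measurable (lebesgue_on U)"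
    by (rule continuous_imp_measurable_on_sets_lebesgue[OF contU leb])
  then have "(\<lambda>x. if x \<in> U then f x else 0) \<in> borel_measurable lebesgue"
    by (rule borel_measurable_if_I[OF _ leb])
  then have "(\<lambda>x. if x \<in> U then f x else 0) \<in> borel_measurable (lebesgue_on {a..b})"
    by (rule measurable_restrict_space1)
  then show ?thesis
  proof (rule measurable_discrete_difference[where X = "breaks \<inter> {a..b}"])
    show "{x} \<in> sets (lebesgue_on {a..b})" if "x \<in> breaks \<inter> {a..b}" for x
      using that by (simp add: sets_restrict_space_iff)
    show "(if x \<in> U then f x else 0) = f x"
      if "x \<in> space (lebesgue_on {a..b})" "x \<notin> breaks \<inter> {a..b}" for x
      using between_breaks[of x] that by (force simp: U_def)
  qed auto
qed

lemma bounded: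
  obtains B where "\<And>x. x \<in> {a..b} \<Longrightarrow> \<bar>f x\<bar> \<le> B"
proof -
  have "bounded (f ` {c j<..<c (Suc j)})" if "j < r" for j
    using lip[OF that] by (intro bounded_uniformly_continuous_image lipschitz_on_uniformly_continuous) auto
  then have "bounded (f ` (breaks \<union> (\<Union>j<r. {c j<..<c (Suc j)})))"
    by (auto simp: image_Un image_UN finite_imp_bounded intro!: bounded_UN)
  moreover have "{a..b} \<subseteq> breaks \<union> (\<Union>j<r. {c j<..<c (Suc j)})"
  proof
    fix x assume x: "x \<in> {a..b}"
    show "x \<in> breaks \<union> (\<Union>j<r. {c j<..<c (Suc j)})"
    proof (cases "x \<in> breaks")
      case False
      then obtain i where "i < r" "c i < x" "x < c (Suc i)"
        using between_breaks[OF x] by blast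
      then show ?thesis by auto
    qed simp
  qed
  ultimately have "bounded (f ` {a..b})"
    by (meson bounded_subset image_mono)
  then obtain B where "\<forall>x\<in>{a..b}. \<bar>f x\<bar> \<le> B"
    by (auto simp: bounded_iff)
  then show ?thesis
    by (intro that) blast
qed

lemma AE_le_M: "AE x in lebesgue_on {a..b}. \<bar>f x\<bar> \<le> M" and M_nonneg: "0 \<le> M"
proof -
  obtain B where B: "\<And>x. x \<in> {a..b} \<Longrightarrow> \<bar>f x\<bar> \<le> B" using bounded by blast
  have bd: "AE x in lebesgue_on {a..b}. \<bar>f x\<bar> \<le> B"
    using B by (intro AE_I2) auto
  show "AE x in lebesgue_on {a..b}. \<bar>f x\<bar> \<le> M" "0 \<le> M"
    using Lp_norm_infinity_bounds[OF ab measurable bd] by auto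
qed

text \<open>Off the breakpoints \<^term>\<open>f\<close> is continuous, so its essential supremum bounds it pointwise:
  every one-sided neighbourhood of \<^term>\<open>x\<close> contains a point where the bound holds, and the
  neighbourhood of size \<^term>\<open>e / L\<close> changes the value by at most \<^term>\<open>e\<close>.\<close>

lemma abs_le_M:
  assumes x: "x \<in> {a..b}" "x \<notin> breaks"
  shows "\<bar>f x\<bar> \<le> M"
proof (rule field_le_epsilon)
  fix e :: real assume e: "0 < e"
  obtain i where i: "i < r" "c i < x" "x < c (Suc i)"
    using between_breaks[OF x] by blast
  define d where "d = min (c (Suc i)) (x + e / L)"
  have d: "x < d" using i e L by (simp add: d_def)
  have sub: "{x..d} \<subseteq> {a..b}"
    using piece_subset[OF i(1)] i x by (auto simp: d_def)
  obtain y where y: "x < y" "y < d" "\<bar>f y\<bar> \<le> M"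
    using AE_Icc_ex[OF AE_le_M d sub] by blast
  have "dist (f x) (f y) \<le> L * dist x y"
    using i y by (intro lipschitz_onD[OF lip[OF i(1)]]) (auto simp: d_def)
  also have "\<dots> \<le> L * (e / L)"
    using y L by (intro mult_left_mono) (auto simp: dist_real_def d_def)
  finally show "\<bar>f x\<bar> \<le> M + e"
    using y L by (auto simp: dist_real_def)
qed

lemma integrable: "integrable (lebesgue_on {a..b}) f"
proof -
  obtain B where B: "\<And>x. x \<in> {a..b} \<Longrightarrow> \<bar>f x\<bar> \<le> B" using bounded by blast
  show ?thesis
    by (rule integrableI_bounded_set[where A = "{a..b}" and B = B])
      (use measurable B ab in \<open>auto simp: sets_restrict_space_iff emeasure_restrict_space intro!: AE_I2\<close>)
qed

lemma integrable_on_Icc: "f integrable_on {a..b}"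
  by (rule integrable_on_lebesgue_on[OF integrable]) simp

lemma integrable_on_sub: "{x..y} \<subseteq> {a..b} \<Longrightarrow> f integrable_on {x..y}"
  by (rule integrable_subinterval_real[OF integrable_on_Icc])

text \<open>The Henstock--Kurzweil integral is additive over adjacent intervals and tolerates finitely many
  exceptional points in bounds, so the estimates below use it.\<close>

lemma volterra_eq_integral:
  assumes "x \<in> {a..b}"
  shows "volterra a f x = integral {a..x} f"
  unfolding volterra_def
  by (rule lebesgue_integral_eq_integral)
    (use assms in \<open>auto intro: integrable_subinterval[OF integrable]\<close>)

lemma volterra_diff_le:
  assumes "x \<in> {a..b}" "y \<in> {a..b}"
  shows "\<bar>volterra a f y - volterra a f x\<bar> \<le> M * \<bar>y - x\<bar>"
proof -
  have *: "\<bar>volterra a f y - volterra a f x\<bar> \<le> M * (y - x)" if "x \<in> {a..b}" "y \<in> {a..b}" "x \<le> y" for x y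
  proof -
    have sub: "{x..y} \<subseteq> {a..b}" using that by auto
    have "integral {a..x} f + integral {x..y} f = integral {a..y} f"
      using that by (intro Henstock_Kurzweil_Integration.integral_combine integrable_on_sub) auto
    moreover have "norm (integral {x..y} f) \<le> M * measure lborel {x..y}"
    proof (rule has_integral_bound_real[where S = breaks])
      show "(f has_integral integral {x..y} f) {x..y}"
        using integrable_on_sub[OF sub] by (rule integrable_integral)
      show "norm (f z) \<le> M" if "z \<in> {x..y} - breaks" for z
        using abs_le_M[of z] that sub by auto
    qed (use M_nonneg in auto)
    ultimately show ?thesis
      using that by (simp add: volterra_eq_integral)
  qed
  show ?thesis
    using *[of x y] *[of y x] assms by (cases "x \<le> y") auto
qed

lemma continuous_volterra: "continuous_on {a..b} (volterra a f)"
proof -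
  have "M-lipschitz_on {a..b} (volterra a f)"
    using volterra_diff_le M_nonneg by (intro lipschitz_onI) (auto simp: dist_real_def abs_minus_commute)
  then show ?thesis by (rule lipschitz_on_continuous_on)
qed

lemma mean_mult: "mean a b f * (b - a) = volterra a f b"
  using ab by (simp add: mean_def volterra_def)

lemma abs_mean_le: "\<bar>mean a b f\<bar> \<le> M"
proof -
  have "volterra a f a = 0"
    using ab by (simp add: volterra_eq_integral)
  then have "\<bar>mean a b f * (b - a)\<bar> \<le> M * (b - a)"
    using volterra_diff_le[of a b] ab by (simp add: mean_mult)
  then show ?thesis using ab by (simp add: abs_mult)
qed

text \<open>Subtracting a constant keeps the pieces and their Lipschitz constant, so everything in the
  locale also applies to the centred function.\<close>

lemma piecewise_lipschitz_cen: "piecewise_lipschitz a b L r c (cen a b f)"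
proof
  show "L-lipschitz_on {c j<..<c (Suc j)} (cen a b f)" if "j < r" for j
    using lip[OF that] by (auto simp: lipschitz_on_def cen_def dist_real_def)
qed (use ab part L in auto)

lemma volterra_cen:
  assumes "x \<in> {a..b}"
  shows "volterra a (cen a b f) x = volterra a f x - mean a b f * (x - a)"
proof -
  interpret cen: piecewise_lipschitz a b L r c "cen a b f"
    by (rule piecewise_lipschitz_cen)
  have "integral {a..x} (\<lambda>t. f t - mean a b f) = integral {a..x} f - integral {a..x} (\<lambda>t. mean a b f)"
    using assms by (intro integral_diff integrable_on_sub) auto
  then show ?thesis
    using assms by (simp add: volterra_eq_integral cen.volterra_eq_integral) (simp add: cen_def[abs_def])
qed

lemma mean_cen: "mean a b (cen a b f) = 0"
proof -
  interpret cen: piecewise_lipschitz a b L r c "cen a b f"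
    by (rule piecewise_lipschitz_cen)
  have "mean a b (cen a b f) * (b - a) = 0"
    using volterra_cen[of b] ab by (simp add: cen.mean_mult mean_mult)
  then show ?thesis using ab by simp
qed

lemma cen_cen: "cen a b (cen a b f) = cen a b f"
  by (simp add: cen_def[of a b "cen a b f"] mean_cen fun_eq_iff)

section \<open>The error of the trapezoidal rule\<close>

text \<open>The trapezoidal rule is exact for the constant function equal to the average of the endpoint
  values. Since \<^term>\<open>f\<close> differs from each endpoint value by at most \<^term>\<open>Q\<close>, it also differs
  from their average by at most \<^term>\<open>Q\<close>, except perhaps at breakpoints.\<close>

lemma cell_error:
  assumes n: "1 \<le> n" and j: "j < n"
    and Q: "\<And>x. x \<in> {grid a b n j..grid a b n (Suc j)} - breaks \<Longrightarrow>
       \<bar>f x - f (grid a b n j)\<bar> \<le> Q \<and> \<bar>f x - f (grid a b n (Suc j))\<bar> \<le> Q"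
    and "0 \<le> Q"
  shows "\<bar>(b - a) / (2 * real n) * (f (grid a b n j) + f (grid a b n (Suc j)))
     - integral {grid a b n j..grid a b n (Suc j)} f\<bar> \<le> Q * ((b - a) / real n)"
proof -
  define u where "u = grid a b n j"
  define v where "v = grid a b n (Suc j)"
  define h where "h = (b - a) / real n"
  define m where "m = (f u + f v) / 2"
  have h: "0 < h" "v = u + h" using ab n by (simp_all add: h_def u_def v_def grid_Suc)
  have sub: "{u..v} \<subseteq> {a..b}"
    using grid_in_Icc[of a b n j] grid_in_Icc[of a b n "Suc j"] ab n j by (auto simp: u_def v_def)
  have "((\<lambda>x. f x - m) has_integral (integral {u..v} f - h * m)) {u..v}"
    using has_integral_const_real[of m u v] h integrable_on_sub[OF sub]
    by (intro has_integral_diff integrable_integral) auto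
  then have "norm (integral {u..v} f - h * m) \<le> Q * measure lborel {u..v}"
  proof (rule has_integral_bound_real[where S = breaks, rotated 2])
    show "norm (f x - m) \<le> Q" if "x \<in> {u..v} - breaks" for x
      using Q[folded u_def v_def, OF that] by (auto simp: m_def field_simps abs_le_iff)
  qed (use \<open>0 \<le> Q\<close> in auto)
  moreover have "(b - a) / (2 * real n) * (f u + f v) = h * m"
    by (simp add: h_def m_def)
  ultimately show ?thesis
    using h by (simp add: u_def[symmetric] v_def[symmetric] h_def[symmetric] abs_minus_commute)
qed

text \<open>A closed cell that avoids the breakpoints lies inside a single piece.\<close>

lemma cell_lipschitz:
  assumes n: "1 \<le> n" and j: "j < n"
    and good: "breaks \<inter> {grid a b n j..grid a b n (Suc j)} = {}"
    and x: "x \<in> {grid a b n j..grid a b n (Suc j)}" and y: "y \<in> {grid a b n j..grid a b n (Suc j)}"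
  shows "\<bar>f x - f y\<bar> \<le> L * ((b - a) / real n)"
proof -
  have g: "grid a b n j \<in> {a..b}"
    using grid_in_Icc[of a b n j] ab n j by auto
  have le: "grid a b n j \<le> grid a b n (Suc j)"
    using grid_mono[of a b j "Suc j" n] ab by simp
  have "grid a b n j \<notin> breaks"
    using good le by auto
  then obtain i where i: "i < r" "c i < grid a b n j" "grid a b n j < c (Suc i)"
    using between_breaks[OF g] by blast
  have "c (Suc i) \<notin> {grid a b n j..grid a b n (Suc j)}"
    using good i(1) by (metis Suc_leI disjoint_iff atLeastAtMost_iff image_eqI le0)
  then have "grid a b n (Suc j) < c (Suc i)" using i by auto
  then have "dist (f x) (f y) \<le> L * dist x y"
    using x y i by (intro lipschitz_onD[OF lip[OF i(1)]]) auto
  also have "dist x y \<le> (b - a) / real n"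
    using x y by (auto simp: dist_real_def grid_Suc)
  finally show ?thesis
    using L by (simp add: dist_real_def)
qed

text \<open>The primitive at a grid point is approximated by adding up cell errors. A cell without
  breakpoints contributes \<^term>\<open>L * h\<^sup>2\<close>, and at most \<^term>\<open>n\<close> of them add up to
  \<^term>\<open>h * (L * (b - a))\<close>. A cell with a breakpoint contributes up to \<^term>\<open>2 * M * h\<close>; each of
  the \<^term>\<open>r + 1\<close> breakpoints spoils at most two cells, and
  \<^term>\<open>2 * (r + 1) \<le> 4 * r\<close>, so these cells add up to \<^term>\<open>h * (8 * real r * M)\<close>.\<close>

lemma trapezoid_error:
  assumes n: "1 \<le> n" and bd: "breakpoint_samples_bounded a b n r c f" and k: "k \<le> n"
  shows "\<bar>dvolterra a b n (samples a b n f) k - volterra a f (grid a b n k)\<bar>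
    \<le> (b - a) / real n * (L * (b - a) + 8 * real r * M)"
proof -
  define h where "h = (b - a) / real n"
  have h: "0 < h" "b - a = real n * h" using ab n by (auto simp: h_def)
  define cell where "cell = (\<lambda>j. {grid a b n j..grid a b n (Suc j)})"
  define bad where "bad = {j. j < n \<and> breaks \<inter> cell j \<noteq> {}}"
  define err where "err = (\<lambda>j. (b - a) / (2 * real n) * (f (grid a b n j) + f (grid a b n (Suc j)))
     - integral (cell j) f)"
  \<comment> \<open>A trapezoid sees the samples, which the essential supremum alone does not control at breakpoints.\<close>
  have sample: "\<bar>f (grid a b n i)\<bar> \<le> M" if "i \<le> n" for i
    using that bd abs_le_M[of "grid a b n i"] grid_in_Icc[of a b n i] ab n
    by (auto simp: breakpoint_samples_bounded_def)
  have err: "\<bar>err j\<bar> \<le> L * h * h + (if j \<in> bad then 2 * M * h else 0)" if j: "j < n" for j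
  proof -
    define Q where "Q = L * h + (if j \<in> bad then 2 * M else 0)"
    have Q: "0 \<le> Q" using L h M_nonneg by (simp add: Q_def)
    have sub: "cell j \<subseteq> {a..b}"
      using grid_in_Icc[of a b n j] grid_in_Icc[of a b n "Suc j"] ab n j by (auto simp: cell_def)
    have "\<bar>f x - f (grid a b n j)\<bar> \<le> Q \<and> \<bar>f x - f (grid a b n (Suc j))\<bar> \<le> Q"
      if x: "x \<in> cell j - breaks" for x
    proof (cases "j \<in> bad")
      case True
      have "\<bar>f x\<bar> \<le> M" using abs_le_M[of x] x sub by auto
      moreover have "0 \<le> L * h" using L h by simp
      ultimately show ?thesis
        using True sample[of j] sample[of "Suc j"] j unfolding Q_def by auto
    next
      case False
      then have "breaks \<inter> {grid a b n j..grid a b n (Suc j)} = {}"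
        using j by (auto simp: bad_def cell_def)
      then show ?thesis
        using x cell_lipschitz[OF n j, of x] False grid_mono[of a b j "Suc j" n] ab
        by (auto simp: Q_def h_def cell_def)
    qed
    then have "\<bar>err j\<bar> \<le> Q * h"
      unfolding err_def cell_def h_def using Q by (intro cell_error n j) (auto simp: h_def)
    then show ?thesis by (simp add: Q_def algebra_simps split: if_splits)
  qed
  have card_bad: "card bad \<le> 4 * r"
  proof -
    have "bad = (\<Union>i\<in>{0..r}. {j. j < n \<and> c i \<in> cell j})"
      by (auto simp: bad_def)
    then have "card bad \<le> (\<Sum>i\<in>{0..r}. card {j. j < n \<and> c i \<in> cell j})"
      using card_UN_le[of "{0..r}" "\<lambda>i. {j. j < n \<and> c i \<in> cell j}"] by simp
    also have "\<dots> \<le> (\<Sum>i\<in>{0..r}. 2)"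
      unfolding cell_def by (intro sum_mono card_cells_containing_le ab n)
    also have "\<dots> \<le> 4 * r" using r_ge_1 by simp
    finally show ?thesis .
  qed
  have "dvolterra a b n (samples a b n f) k - volterra a f (grid a b n k) = (\<Sum>j<k. err j)"
    using grid_in_Icc[of a b n k] ab n k integral_eq_sum_cells[OF _ n integrable_on_Icc k]
    by (simp add: volterra_eq_integral dvolterra_def samples_def err_def cell_def sum_subtractf sum_distrib_left)
  then have "\<bar>dvolterra a b n (samples a b n f) k - volterra a f (grid a b n k)\<bar> \<le> (\<Sum>j<k. \<bar>err j\<bar>)"
    by simp
  also have "\<dots> \<le> (\<Sum>j<n. \<bar>err j\<bar>)"
    using k by (intro sum_mono2) auto
  also have "\<dots> \<le> (\<Sum>j<n. L * h * h + (if j \<in> bad then 2 * M * h else 0))"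
    using err by (intro sum_mono) auto
  also have "\<dots> = h * (L * (b - a) + 2 * real (card bad) * M)"
  proof -
    have "{j. j < n \<and> j \<in> bad} = bad" by (auto simp: bad_def)
    then have "(\<Sum>j<n. if j \<in> bad then 2 * M * h else 0) = real (card bad) * (2 * M * h)"
      by (simp add: sum.If_cases Int_def)
    then show ?thesis by (simp add: sum.distrib h(2) algebra_simps)
  qed
  also have "\<dots> \<le> h * (L * (b - a) + 8 * real r * M)"
    using card_bad h M_nonneg by (intro mult_left_mono add_left_mono mult_right_mono) auto
  finally show ?thesis by (simp add: h_def)
qed

section \<open>The norm estimates\<close>

lemma error_bound_eq:
  "error_bound a b n r L p f = (b - a) / real n * (L * (b - a) + real r * M) * (b - a) powr real_of_ereal (1 / p)"
  using ab by (simp add: error_bound_def powr_add)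

text \<open>On a cell the primitive is within \<^term>\<open>E + M * h\<close> of both discrete endpoint values, where
  \<^term>\<open>E\<close> is the trapezoidal error and \<^term>\<open>M * h\<close> bounds the variation of the primitive.
  Centring subtracts the linear functions \<^term>\<open>mean a b f * (x - a)\<close> and
  \<^term>\<open>dmean n w * (grid a b n i - a)\<close>. They differ by at most \<^term>\<open>E + M * h\<close> again: the slopes
  are the endpoint values of the primitives divided by \<^term>\<open>b - a\<close>, and so differ by at most
  \<^term>\<open>E / (b - a)\<close>, and moving \<^term>\<open>x\<close> to the grid point costs at most \<^term>\<open>M * h\<close>. Since
  \<^term>\<open>r \<ge> 1\<close>, the total is at most twice \<^term>\<open>9 * D\<close>, which gives the constant 18.\<close>

lemma norm_errors:
  assumes n: "1 \<le> n" and bd: "breakpoint_samples_bounded a b n r c f" and p: "1 \<le> p"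
  shows "\<bar>nu_norm a b n p (samples a b n f) - Vp_norm a b p f\<bar> \<le> 18 * error_bound a b n r L p f"
    and "\<bar>nu_norm a b n p (dcen n (samples a b n f)) - Vp_norm a b p (cen a b f)\<bar>
        \<le> 18 * error_bound a b n r L p f"
proof -
  define h where "h = (b - a) / real n"
  define D where "D = h * (L * (b - a) + real r * M)"
  define w where "w = samples a b n f"
  define v where "v = dvolterra a b n w"
  have h: "0 < h" using ab n by (simp add: h_def)
  have D: "0 < D"
    using h L ab M_nonneg by (auto simp: D_def intro!: mult_pos_pos add_pos_nonneg)
  have MD: "h * M + 8 * real r * h * M + h * L * (b - a) \<le> 9 * D"
  proof -
    have "h * M \<le> h * (real r * M)"
      using h M_nonneg r_ge_1 by (intro mult_left_mono mult_right_mono[of 1 "real r" M, simplified]) auto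
    moreover have "0 \<le> h * L * (b - a)" using h L ab by simp
    ultimately show ?thesis by (simp add: D_def algebra_simps)
  qed
  define E where "E = h * (L * (b - a) + 8 * real r * M)"
  have E: "\<bar>v i - volterra a f (grid a b n i)\<bar> \<le> E" if "i \<le> n" for i
    using trapezoid_error[OF n bd that] by (simp add: v_def w_def E_def h_def)
  have ED: "E + M * h \<le> 9 * D" using MD by (simp add: E_def algebra_simps)
  have raw: "\<bar>volterra a f x - v i\<bar> \<le> E + M * h"
    if "x \<in> {a..b}" "i \<le> n" "\<bar>x - grid a b n i\<bar> \<le> h" for x i
  proof -
    have "\<bar>volterra a f x - volterra a f (grid a b n i)\<bar> \<le> M * \<bar>x - grid a b n i\<bar>"
      using that grid_in_Icc[of a b n i] ab n by (intro volterra_diff_le) auto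
    also have "\<dots> \<le> M * h" using that M_nonneg by (intro mult_left_mono) auto
    finally show ?thesis using E[OF that(2)] by linarith
  qed
  have centred: "\<bar>volterra a (cen a b f) x - dvolterra a b n (dcen n w) i\<bar> \<le> 18 * D"
    if x: "x \<in> {a..b}" "i \<le> n" "\<bar>x - grid a b n i\<bar> \<le> h" for x i
  proof -
    define g where "g = grid a b n i"
    have g: "a \<le> g" "g \<le> b" using grid_in_Icc[of a b n i] ab n x by (auto simp: g_def)
    have "\<bar>mean a b f * (x - g)\<bar> \<le> M * h"
      unfolding abs_mult using abs_mean_le x M_nonneg by (intro mult_mono) (auto simp: g_def)
    moreover have "\<bar>(mean a b f - dmean n w) * (g - a)\<bar> \<le> E"
    proof -
      have "\<bar>(mean a b f - dmean n w) * (g - a)\<bar> \<le> \<bar>mean a b f - dmean n w\<bar> * (b - a)"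
        unfolding abs_mult using g by (intro mult_left_mono) auto
      also have "\<dots> = \<bar>(mean a b f - dmean n w) * (b - a)\<bar>"
        using ab by (simp add: abs_mult)
      also have "\<dots> = \<bar>v n - volterra a f (grid a b n n)\<bar>"
        using dmean_mult[OF ab, of n w] n mean_mult by (simp add: v_def left_diff_distrib abs_minus_commute)
      also have "\<dots> \<le> E" by (rule E) simp
      finally show ?thesis .
    qed
    moreover have "volterra a (cen a b f) x - dvolterra a b n (dcen n w) i
      = (volterra a f x - v i) - mean a b f * (x - g) - (mean a b f - dmean n w) * (g - a)"
      using x n by (simp add: volterra_cen dvolterra_dcen v_def g_def algebra_simps)
    ultimately show ?thesis using raw[OF x] ED by linarith
  qed
  have near: "x \<in> {a..b} \<and> \<bar>x - grid a b n j\<bar> \<le> h \<and> \<bar>x - grid a b n (Suc j)\<bar> \<le> h"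
    if "j < n" "x \<in> {grid a b n j..grid a b n (Suc j)}" for j x
    using that grid_in_Icc[of a b n j] grid_in_Icc[of a b n "Suc j"] ab n
    by (auto simp: grid_Suc h_def)
  have eb: "18 * D * (b - a) powr real_of_ereal (1 / p) = 18 * error_bound a b n r L p f"
    by (simp add: error_bound_eq D_def h_def)
  interpret cen: piecewise_lipschitz a b L r c "cen a b f"
    by (rule piecewise_lipschitz_cen)
  have "\<bar>tau_norm a b n p v - Lp_norm a b p (volterra a f)\<bar> \<le> (18 * D) * (b - a) powr real_of_ereal (1 / p)"
  proof (rule tau_norm_Lp_norm_close[OF ab n p _ continuous_volterra])
    fix j x assume j: "j < n" and "x \<in> {grid a b n j..grid a b n (Suc j)}"
    then show "\<bar>volterra a f x - v j\<bar> \<le> 18 * D \<and> \<bar>volterra a f x - v (Suc j)\<bar> \<le> 18 * D"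
      using near[of j x] raw[of x j] raw[of x "Suc j"] ED D by auto
  qed (use D in simp)
  then show "\<bar>nu_norm a b n p (samples a b n f) - Vp_norm a b p f\<bar> \<le> 18 * error_bound a b n r L p f"
    unfolding eb by (simp add: nu_norm_def Vp_norm_def v_def w_def)
  have "\<bar>tau_norm a b n p (dvolterra a b n (dcen n w)) - Lp_norm a b p (volterra a (cen a b f))\<bar>
      \<le> (18 * D) * (b - a) powr real_of_ereal (1 / p)"
  proof (rule tau_norm_Lp_norm_close[OF ab n p _ cen.continuous_volterra])
    fix j x assume j: "j < n" and "x \<in> {grid a b n j..grid a b n (Suc j)}"
    then show "\<bar>volterra a (cen a b f) x - dvolterra a b n (dcen n w) j\<bar> \<le> 18 * D \<and>
        \<bar>volterra a (cen a b f) x - dvolterra a b n (dcen n w) (Suc j)\<bar> \<le> 18 * D"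
      using near[of j x] centred[of x j] centred[of x "Suc j"] by auto
  qed (use D in simp)
  then show "\<bar>nu_norm a b n p (dcen n (samples a b n f)) - Vp_norm a b p (cen a b f)\<bar>
      \<le> 18 * error_bound a b n r L p f"
    unfolding eb by (simp add: nu_norm_def Vp_norm_def w_def)
qed

text \<open>Centring is idempotent, for functions and for samples, so the preceding estimate applied to the
  centred function has the same left-hand side, and its bound involves the centred function.\<close>

lemma norm_error_cen:
  assumes n: "1 \<le> n" and bd: "breakpoint_samples_bounded a b n r c (cen a b f)" and p: "1 \<le> p"
  shows "\<bar>nu_norm a b n p (dcen n (samples a b n f)) - Vp_norm a b p (cen a b f)\<bar>
        \<le> 18 * error_bound a b n r L p (cen a b f)"
proof -
  interpret cen: piecewise_lipschitz a b L r c "cen a b f"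
    by (rule piecewise_lipschitz_cen)
  show ?thesis
    using cen.norm_errors(2)[OF n bd p] by (simp add: cen_cen dcen_samples_cen[OF n])
qed

end

theorem theorem5p1:
  "\<exists>C>0. \<forall>(a::real) (b::real) (n::nat) (r::nat) (c::nat \<Rightarrow> real) (L::real) (f::real \<Rightarrow> real) (p::ereal).
     a < b \<longrightarrow> 1 \<le> n \<longrightarrow> is_partition a b r c \<longrightarrow> 0 < L \<longrightarrow>
     (\<forall>j<r. L-lipschitz_on {c j<..<c (Suc j)} f) \<longrightarrow> 1 \<le> p \<longrightarrow>
       (breakpoint_samples_bounded a b n r c f \<longrightarrow>
          \<bar>nu_norm a b n p (samples a b n f) - Vp_norm a b p f\<bar>
            \<le> C * error_bound a b n r L p f \<and>
          \<bar>nu_norm a b n p (dcen n (samples a b n f)) - Vp_norm a b p (cen a b f)\<bar>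
            \<le> C * error_bound a b n r L p f) \<and>
       (breakpoint_samples_bounded a b n r c (cen a b f) \<longrightarrow>
          \<bar>nu_norm a b n p (dcen n (samples a b n f)) - Vp_norm a b p (cen a b f)\<bar>
            \<le> C * error_bound a b n r L p (cen a b f))"
proof (intro exI[of _ "18 :: real"] conjI allI impI)
  fix a b L :: real and n r :: nat and c :: "nat \<Rightarrow> real" and f :: "real \<Rightarrow> real" and p :: ereal
  assume "a < b" and n: "1 \<le> n" and "is_partition a b r c" "0 < L"
    and "\<forall>j<r. L-lipschitz_on {c j<..<c (Suc j)} f" and p: "1 \<le> p"
  then interpret piecewise_lipschitz a b L r c f
    by unfold_locales auto
  show "\<bar>nu_norm a b n p (samples a b n f) - Vp_norm a b p f\<bar> \<le> 18 * error_bound a b n r L p f"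
    if "breakpoint_samples_bounded a b n r c f"
    by (rule norm_errors(1)[OF n that p])
  show "\<bar>nu_norm a b n p (dcen n (samples a b n f)) - Vp_norm a b p (cen a b f)\<bar>
      \<le> 18 * error_bound a b n r L p f"
    if "breakpoint_samples_bounded a b n r c f"
    by (rule norm_errors(2)[OF n that p])
  show "\<bar>nu_norm a b n p (dcen n (samples a b n f)) - Vp_norm a b p (cen a b f)\<bar>
      \<le> 18 * error_bound a b n r L p (cen a b f)"
    if "breakpoint_samples_bounded a b n r c (cen a b f)"
    by (rule norm_error_cen[OF n that p])
qed simp

end
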